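(* Let $R$ and $R'$ be rings. If $R'$ is reduced, then every Jordan homomorphism $\varphi:R\to R'$ is the sum of a homomorphism and an antihomomorphism on the commutator ideal $K$ of $R$.
   Context: Rings are associative and not necessarily unital; ideals are two-sided, and the ideal generated by a set is the smallest ideal containing it. Homomorphisms and antihomomorphisms are additive maps with $\alpha(xy)=\alpha(x)\alpha(y)$, respectively $\alpha(xy)=\alpha(y)\alpha(x)$. A ring is reduced if it has no nonzero nilpotent elements. An additive map $\varphi:R\to R'$ is a Jordan homomorphism if $\varphi(x^2)=\varphi(x)^2$ and $\varphi(xyx)=\varphi(x)\varphi(y)\varphi(x)$ for all $x,y\in R$. Let $R_\varphi'$ denote the subring of $R'$ generated by $\varphi(R)$. The commutator ideal $K$ of $R$ is the ideal of $R$ generated by all $[x,y]=xy-yx$, $x,y\in R$. Let $I$ be an ideal of $R$. A Jordan homomorphism $\varphi:R\to R'$ is the sum of a homomorphism and an antihomomorphism on $I$ if there exist a homomorphism $\varphi_1:I\to R_\varphi'$ and an antihomomorphism $\varphi_2:I\to R_\varphi'$ such that: (a) $\varphi|_I=\varphi_1+\varphi_2$; (b) $R_\varphi'$ has ideals $J_1$ and $J_2$ with $\varphi_1(I)\subseteq J_1$, $\varphi_2(I)\subseteq J_2$ and $J_1\cap J_2=\{0\}$; (c) $\varphi_1(ux)=\varphi_1(u)\varphi(x)$ and $\varphi_1(xu)=\varphi(x)\varphi_1(u)$ for all $u\in I$, $x\in R$; (d) $\varphi_2(ux)=\varphi(x)\varphi_2(u)$ and $\varphi_2(xu)=\varphi_2(u)\varphi(x)$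 for all $u\in I$, $x\in R$. *)

theory Defs
  imports Main "HOL.Modules"
begin

(* The type class ring of HOL is associative and does not assume a unit (nor commutativity).
   Subrings and ideals are sets; the ring itself is UNIV, and "generated by" is the
   intersection operator hull. *)

definition additive_subgroup :: "'a::ring set \<Rightarrow> bool" where
  "additive_subgroup S \<longleftrightarrow> 0 \<in> S \<and> (\<forall>x\<in>S. \<forall>y\<in>S. x + y \<in> S) \<and> (\<forall>x\<in>S. - x \<in> S)"

definition is_subring :: "'a::ring set \<Rightarrow> bool" where
  "is_subring S \<longleftrightarrow> additive_subgroup S \<and> (\<forall>x\<in>S. \<forall>y\<in>S. x * y \<in> S)"

text \<open>Two-sided ideals \<open>J\<close> of a subring \<open>S\<close>; the absorption is only by elements of \<open>S\<close>.\<close>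

definition is_ideal :: "'a::ring set \<Rightarrow> 'a set \<Rightarrow> bool" where
  "is_ideal S J \<longleftrightarrow> additive_subgroup J \<and> J \<subseteq> S \<and> (\<forall>s\<in>S. \<forall>u\<in>J. s * u \<in> J \<and> u * s \<in> J)"

text \<open>The library's power operation needs a unit, so \<open>pos_power x n\<close> is \<open>x\<close> to the power \<open>n + 1\<close>.\<close>

primrec pos_power :: "'a::ring \<Rightarrow> nat \<Rightarrow> 'a" where
  "pos_power x 0 = x"
| "pos_power x (Suc n) = pos_power x n * x"

definition nilpotent :: "'a::ring \<Rightarrow> bool" where
  "nilpotent x \<longleftrightarrow> (\<exists>n. pos_power x n = 0)"

text \<open>A property of the whole ring, passed as a type.\<close>

definition reduced_ring :: "'a::ring itself \<Rightarrow> bool" where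
  "reduced_ring _ \<longleftrightarrow> (\<forall>x::'a. nilpotent x \<longrightarrow> x = 0)"

definition jordan_hom :: "('a::ring \<Rightarrow> 'b::ring) \<Rightarrow> bool" where
  "jordan_hom \<phi> \<longleftrightarrow> additive \<phi> \<and> (\<forall>x. \<phi> (x * x) = \<phi> x * \<phi> x) \<and>
     (\<forall>x y. \<phi> (x * y * x) = \<phi> x * \<phi> y * \<phi> x)"

definition generated_image :: "('a::ring \<Rightarrow> 'b::ring) \<Rightarrow> 'b set" where
  "generated_image \<phi> = is_subring hull range \<phi>"

definition commutator_ideal :: "'a::ring set" where
  "commutator_ideal = is_ideal UNIV hull {x * y - y * x | x y. True}"

text \<open>(Anti)homomorphisms between the subrings \<open>I\<close> and \<open>S\<close>; values outside \<open>I\<close> are irrelevant.\<close>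

definition hom_on :: "'a::ring set \<Rightarrow> 'b::ring set \<Rightarrow> ('a \<Rightarrow> 'b) \<Rightarrow> bool" where
  "hom_on I S f \<longleftrightarrow> f ` I \<subseteq> S \<and> (\<forall>u\<in>I. \<forall>v\<in>I. f (u + v) = f u + f v \<and> f (u * v) = f u * f v)"

definition antihom_on :: "'a::ring set \<Rightarrow> 'b::ring set \<Rightarrow> ('a \<Rightarrow> 'b) \<Rightarrow> bool" where
  "antihom_on I S f \<longleftrightarrow> f ` I \<subseteq> S \<and> (\<forall>u\<in>I. \<forall>v\<in>I. f (u + v) = f u + f v \<and> f (u * v) = f v * f u)"

definition sum_hom_antihom_on :: "('a::ring \<Rightarrow> 'b::ring) \<Rightarrow> 'a set \<Rightarrow> bool" where
  "sum_hom_antihom_on \<phi> I \<longleftrightarrow>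
     (\<exists>\<phi>\<^sub>1 \<phi>\<^sub>2.
        hom_on I (generated_image \<phi>) \<phi>\<^sub>1 \<and> antihom_on I (generated_image \<phi>) \<phi>\<^sub>2 \<and>
        (\<forall>u\<in>I. \<phi> u = \<phi>\<^sub>1 u + \<phi>\<^sub>2 u) \<and>
        (\<exists>J\<^sub>1 J\<^sub>2. is_ideal (generated_image \<phi>) J\<^sub>1 \<and> is_ideal (generated_image \<phi>) J\<^sub>2 \<and>
           \<phi>\<^sub>1 ` I \<subseteq> J\<^sub>1 \<and> \<phi>\<^sub>2 ` I \<subseteq> J\<^sub>2 \<and> J\<^sub>1 \<inter> J\<^sub>2 = {0}) \<and>
        (\<forall>u\<in>I. \<forall>x. \<phi>\<^sub>1 (u * x) = \<phi>\<^sub>1 u * \<phi> x \<and> \<phi>\<^sub>1 (x * u) = \<phi> x * \<phi>\<^sub>1 u) \<and>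
        (\<forall>u\<in>I. \<forall>x. \<phi>\<^sub>2 (u * x) = \<phi> x * \<phi>\<^sub>2 u \<and> \<phi>\<^sub>2 (x * u) = \<phi>\<^sub>2 u * \<phi> x))"

end

(* Let hom_defect x y = \<phi>(xy) - \<phi>(x)\<phi>(y) and anti_defect x y = \<phi>(xy) - \<phi>(y)\<phi>(x).
   Their product is 0 for every Jordan homomorphism. In a reduced ring u v = 0 forces
   u s v = 0 = v u, so linearizing gives that all homomorphism defects annihilate all
   antihomomorphism defects. Hence the annihilator of the homomorphism defects and its own
   annihilator are ideals with zero intersection, containing the anti_defects and the
   hom_defects, respectively. Since \<phi>([x,y]) = anti_defect x y + hom_defect x y, the
   commutators split along these two ideals; the elements that split compatibly with
   multiplication form an ideal of R, which therefore contains the commutator ideal. *)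

theory Submission
  imports Defs
begin

section \<open>Ideals and annihilators in reduced rings\<close>

lemma is_subring_hull: "is_subring (is_subring hull X)"
  by (rule hull_in) (auto simp: is_subring_def additive_subgroup_def)

lemma additive_subgroup_diff:
  "additive_subgroup S \<Longrightarrow> x \<in> S \<Longrightarrow> y \<in> S \<Longrightarrow> x - y \<in> S"
  by (metis additive_subgroup_def diff_conv_add_uminus)

text \<open>Annihilators are formed in the whole target ring, while the two ideals sought live in
  the generated subring.\<close>

lemma is_ideal_Int:
  "is_subring S \<Longrightarrow> is_ideal UNIV J \<Longrightarrow> is_ideal S (S \<inter> J)"
  by (auto simp: is_ideal_def is_subring_def additive_subgroup_def)

definition left_annihilator :: "'a::ring set \<Rightarrow> 'a set" where
  "left_annihilator X = {s. \<forall>x\<in>X. s * x = 0}"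

lemma reduced_ring_square_eq_0:
  "reduced_ring TYPE('b::ring) \<Longrightarrow> (x::'b) * x = 0 \<Longrightarrow> x = 0"
  unfolding reduced_ring_def nilpotent_def by (metis pos_power.simps)

lemma reduced_ring_mult_eq_0_commute:
  fixes u v :: "'b::ring"
  assumes "reduced_ring TYPE('b)" "u * v = 0"
  shows "v * u = 0"
proof (rule reduced_ring_square_eq_0[OF assms(1)])
  have "(v * u) * (v * u) = v * (u * v) * u" by (simp add: mult.assoc)
  then show "(v * u) * (v * u) = 0" using assms(2) by simp
qed

lemma reduced_ring_mult_mid_eq_0:
  fixes u v :: "'b::ring"
  assumes "reduced_ring TYPE('b)" "u * v = 0"
  shows "u * s * v = 0"
proof (rule reduced_ring_square_eq_0[OF assms(1)])
  have "(u * s * v) * (u * s * v) = u * s * (v * u) * s * v" by (simp add: mult.assoc)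
  then show "(u * s * v) * (u * s * v) = 0"
    using reduced_ring_mult_eq_0_commute[OF assms] by simp
qed

text \<open>Absorption on the right is where reducedness enters: \<open>s * x = 0\<close> gives
  \<open>s * t * x = 0\<close>.\<close>

lemma reduced_ring_is_ideal_left_annihilator:
  fixes X :: "'b::ring set"
  assumes "reduced_ring TYPE('b)"
  shows "is_ideal UNIV (left_annihilator X)"
  using reduced_ring_mult_mid_eq_0[OF assms]
  by (auto simp: is_ideal_def additive_subgroup_def left_annihilator_def distrib_right mult.assoc)

text \<open>Such an \<open>s\<close> annihilates itself, so its square is zero.\<close>

lemma reduced_ring_left_annihilator_Int:
  fixes X :: "'b::ring set"
  assumes "reduced_ring TYPE('b)" "s \<in> left_annihilator X"
    "s \<in> left_annihilator (left_annihilator X)"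
  shows "s = 0"
  using assms reduced_ring_square_eq_0 by (auto simp: left_annihilator_def)

text \<open>Polarization of \<open>P x * Q x = 0\<close> for additive \<open>P\<close>, \<open>Q\<close>; here \<open>p = P x\<close>, \<open>p' = P y\<close>, and
  likewise for \<open>q\<close>.\<close>

lemma reduced_ring_polarize:
  fixes p q p' q' :: "'b::ring"
  assumes "reduced_ring TYPE('b)" "p * q = 0" "p' * q' = 0" "(p + p') * (q + q') = 0"
  shows "p * q' = 0"
proof (rule reduced_ring_square_eq_0[OF assms(1)])
  have "p * q' + p' * q = 0"
    using assms(2-4) by (simp add: distrib_left distrib_right add.commute)
  \<comment> \<open>Squaring with one factor replaced puts \<open>q' * p'\<close> in the middle,
    which vanishes because \<open>p' * q'\<close> does.\<close>
  then have "p * q' = - (p' * q)" by (simp add: eq_neg_iff_add_eq_0)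
  then have "(p * q') * (p * q') = (p * q') * (- (p' * q))" by simp
  also have "\<dots> = - (p * (q' * p') * q)" by (simp add: mult.assoc)
  finally have "(p * q') * (p * q') = - (p * (q' * p') * q)" .
  then show "(p * q') * (p * q') = 0"
    using reduced_ring_mult_eq_0_commute[OF assms(1,3)] by simp
qed

section \<open>Jordan homomorphisms and their defects\<close>

locale jordan_hom_to_reduced =
  fixes \<phi> :: "'a::ring \<Rightarrow> 'b::ring"
  assumes reduced: "reduced_ring TYPE('b)"
    and jordan: "jordan_hom \<phi>"
begin

lemma add: "\<phi> (x + y) = \<phi> x + \<phi> y"
  and diff: "\<phi> (x - y) = \<phi> x - \<phi> y"
  and minus: "\<phi> (- x) = - \<phi> x"
  and zero: "\<phi> 0 = 0"
  using jordan by (auto simp: jordan_hom_def additive.add additive.diff additive.minus additive.zero)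

lemma square: "\<phi> (x * x) = \<phi> x * \<phi> x"
  and triple: "\<phi> (x * y * x) = \<phi> x * \<phi> y * \<phi> x"
  using jordan by (auto simp: jordan_hom_def)

lemma square_polarized: "\<phi> (x * y) + \<phi> (y * x) = \<phi> x * \<phi> y + \<phi> y * \<phi> x"
  using square[of "x + y"] by (simp add: add square algebra_simps)

lemma mult_swap: "\<phi> (y * x) = \<phi> x * \<phi> y + \<phi> y * \<phi> x - \<phi> (x * y)"
  by (metis square_polarized add_diff_cancel_left')

lemma triple_polarized:
  "\<phi> (x * y * z) + \<phi> (z * y * x) = \<phi> x * \<phi> y * \<phi> z + \<phi> z * \<phi> y * \<phi> x"
  using triple[of "x + z" y] by (simp add: add triple distrib_left distrib_right add_ac)

definition hom_defect :: "'a \<Rightarrow> 'a \<Rightarrow> 'b" where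
  "hom_defect x y = \<phi> (x * y) - \<phi> x * \<phi> y"

definition anti_defect :: "'a \<Rightarrow> 'a \<Rightarrow> 'b" where
  "anti_defect x y = \<phi> (x * y) - \<phi> y * \<phi> x"

lemma hom_defect_add:
  "hom_defect (x + x') y = hom_defect x y + hom_defect x' y"
  "hom_defect x (y + y') = hom_defect x y + hom_defect x y'"
  by (simp_all add: hom_defect_def add algebra_simps)

lemma anti_defect_add:
  "anti_defect (x + x') y = anti_defect x y + anti_defect x' y"
  "anti_defect x (y + y') = anti_defect x y + anti_defect x y'"
  by (simp_all add: anti_defect_def add algebra_simps)

text \<open>In the expansion, the two unmixed terms are values of \<phi> by \<open>square\<close>
  and \<open>triple\<close>. The mixed terms form the polarized triple identity at \<open>x\<close>,
  \<open>y\<close>, \<open>x * y\<close>, and associativity cancels everything.\<close>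

lemma hom_defect_mult_anti_defect_same: "hom_defect x y * anti_defect x y = 0"
proof -
  have "hom_defect x y * anti_defect x y =
    \<phi> (x * y) * \<phi> (x * y) + \<phi> x * (\<phi> y * \<phi> y) * \<phi> x
      - (\<phi> x * \<phi> y * \<phi> (x * y) + \<phi> (x * y) * \<phi> y * \<phi> x)"
    by (simp add: hom_defect_def anti_defect_def algebra_simps)
  also have "\<dots> = \<phi> ((x * y) * (x * y)) + \<phi> (x * (y * y) * x)
      - (\<phi> (x * y * (x * y)) + \<phi> ((x * y) * y * x))"
    using triple_polarized[of x y "x * y"] by (simp only: triple square)
  finally show ?thesis by (simp add: mult.assoc)
qed

lemma hom_defect_mult_anti_defect: "hom_defect x y * anti_defect z w = 0"
proof -
  have same_left: "hom_defect x y * anti_defect x w = 0" for x y w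
    by (rule reduced_ring_polarize[OF reduced, where p' = "hom_defect x w" and q = "anti_defect x y"])
      (use hom_defect_mult_anti_defect_same[of x "y + w"] in
        \<open>simp_all only: hom_defect_add anti_defect_add hom_defect_mult_anti_defect_same\<close>)
  have same_right: "hom_defect x y * anti_defect z y = 0" for x y z
    by (rule reduced_ring_polarize[OF reduced, where p' = "hom_defect z y" and q = "anti_defect x y"])
      (use hom_defect_mult_anti_defect_same[of "x + z" y] in
        \<open>simp_all only: hom_defect_add anti_defect_add hom_defect_mult_anti_defect_same\<close>)
  \<comment> \<open>The last polarization is in the first argument, with \<open>y + w\<close> as
    second argument of the antihomomorphism defects; \<open>same_right\<close> then removes the
    summand at \<open>y\<close>.\<close>
  have "hom_defect x y * (anti_defect z y + anti_defect z w) = 0"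
  proof (rule reduced_ring_polarize[OF reduced,
        where p' = "hom_defect z y" and q = "anti_defect x y + anti_defect x w"])
    show "(hom_defect x y + hom_defect z y) *
      (anti_defect x y + anti_defect x w + (anti_defect z y + anti_defect z w)) = 0"
      using same_left[of "x + z" y "y + w"] by (simp add: hom_defect_add anti_defect_add add_ac)
  qed (simp_all add: same_left distrib_left)
  then show ?thesis by (simp add: distrib_left same_right)
qed

section \<open>The two complementary ideals\<close>

definition hom_side :: "'b set" where
  "hom_side = left_annihilator (range (case_prod hom_defect))"

text \<open>Annihilating \<open>hom_side\<close>, rather than the antihomomorphism defects, forces
  the two ideals to meet in zero.\<close>

definition anti_side :: "'b set" where
  "anti_side = left_annihilator hom_side"

lemma anti_defect_in_hom_side: "anti_defect x y \<in> hom_side"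
  using reduced_ring_mult_eq_0_commute[OF reduced hom_defect_mult_anti_defect]
  by (auto simp: hom_side_def left_annihilator_def)

lemma hom_defect_in_anti_side: "hom_defect x y \<in> anti_side"
  unfolding anti_side_def hom_side_def left_annihilator_def
  using reduced_ring_mult_eq_0_commute[OF reduced] by auto

lemma is_ideal_hom_side: "is_ideal UNIV hom_side"
  and is_ideal_anti_side: "is_ideal UNIV anti_side"
  by (simp_all add: hom_side_def anti_side_def reduced_ring_is_ideal_left_annihilator[OF reduced])

lemma hom_side_mult_anti_side: "a \<in> hom_side \<Longrightarrow> b \<in> anti_side \<Longrightarrow> a * b = 0"
  using reduced_ring_mult_eq_0_commute[OF reduced]
  by (auto simp: anti_side_def left_annihilator_def)

lemma side_Int: "s \<in> hom_side \<Longrightarrow> s \<in> anti_side \<Longrightarrow> s = 0"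
  unfolding anti_side_def hom_side_def
  by (rule reduced_ring_left_annihilator_Int[OF reduced])

lemma side_closed:
  "a \<in> hom_side \<Longrightarrow> a' \<in> hom_side \<Longrightarrow> a + a' \<in> hom_side"
  "a \<in> hom_side \<Longrightarrow> a' \<in> hom_side \<Longrightarrow> a - a' \<in> hom_side"
  "a \<in> hom_side \<Longrightarrow> - a \<in> hom_side"
  "a \<in> hom_side \<Longrightarrow> a * s \<in> hom_side"
  "a \<in> hom_side \<Longrightarrow> s * a \<in> hom_side"
  "0 \<in> hom_side"
  "b \<in> anti_side \<Longrightarrow> b' \<in> anti_side \<Longrightarrow> b + b' \<in> anti_side"
  "b \<in> anti_side \<Longrightarrow> b' \<in> anti_side \<Longrightarrow> b - b' \<in> anti_side"
  "b \<in> anti_side \<Longrightarrow> - b \<in> anti_side"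
  "b \<in> anti_side \<Longrightarrow> b * s \<in> anti_side"
  "b \<in> anti_side \<Longrightarrow> s * b \<in> anti_side"
  "0 \<in> anti_side"
  using is_ideal_hom_side is_ideal_anti_side
  by (auto simp: is_ideal_def additive_subgroup_diff) (auto simp: additive_subgroup_def)

lemma side_decomposition_unique:
  assumes "a + b = a' + b'" "a \<in> hom_side" "a' \<in> hom_side" "b \<in> anti_side" "b' \<in> anti_side"
  shows "a = a'" "b = b'"
proof -
  have "a - a' = b' - b" using assms(1) by (simp add: algebra_simps)
  then have "a - a' = 0"
    using side_Int side_closed assms by metis
  then show "a = a'" "b = b'" using assms(1) by simp_all
qed

text \<open>The two sides differ by \<open>a * hom_defect x y\<close>, a product across the two
  ideals.\<close>

lemma hom_side_mult_map:
  assumes "a \<in> hom_side"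
  shows "a * \<phi> (x * y) = a * \<phi> x * \<phi> y"
  using hom_side_mult_anti_side[OF assms hom_defect_in_anti_side[of x y]]
  by (simp add: hom_defect_def right_diff_distrib mult.assoc)

lemma map_mult_anti_side:
  assumes "b \<in> anti_side"
  shows "\<phi> (x * y) * b = \<phi> y * \<phi> x * b"
  using hom_side_mult_anti_side[OF anti_defect_in_hom_side assms]
  by (simp add: anti_defect_def left_diff_distrib)

section \<open>The generated subring and the splitting elements\<close>

lemma is_subring_generated_image: "is_subring (generated_image \<phi>)"
  unfolding generated_image_def by (rule is_subring_hull)

lemma map_in_generated_image: "\<phi> x \<in> generated_image \<phi>"
  unfolding generated_image_def by (rule hull_inc) simp

lemma generated_image_closed:
  "a \<in> generated_image \<phi> \<Longrightarrow> b \<in> generated_image \<phi> \<Longrightarrow> a + b \<in> generated_image \<phi>"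
  "a \<in> generated_image \<phi> \<Longrightarrow> b \<in> generated_image \<phi> \<Longrightarrow> a - b \<in> generated_image \<phi>"
  "a \<in> generated_image \<phi> \<Longrightarrow> - a \<in> generated_image \<phi>"
  "a \<in> generated_image \<phi> \<Longrightarrow> b \<in> generated_image \<phi> \<Longrightarrow> a * b \<in> generated_image \<phi>"
  "0 \<in> generated_image \<phi>"
  using is_subring_generated_image
  by (auto simp: is_subring_def additive_subgroup_diff) (auto simp: additive_subgroup_def)

lemma defect_in_generated_image:
  "hom_defect x y \<in> generated_image \<phi>" "anti_defect x y \<in> generated_image \<phi>"
  by (simp_all add: hom_defect_def anti_defect_def generated_image_closed map_in_generated_image)

text \<open>The condition on \<open>\<phi> (x * u)\<close> is left out, as \<open>mult_swap\<close> supplies it.\<close>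

definition splits :: "'a \<Rightarrow> 'b \<Rightarrow> 'b \<Rightarrow> bool" where
  "splits u a b \<longleftrightarrow>
     a \<in> generated_image \<phi> \<inter> hom_side \<and> b \<in> generated_image \<phi> \<inter> anti_side \<and>
     \<phi> u = a + b \<and> (\<forall>x. \<phi> (u * x) = a * \<phi> x + \<phi> x * b)"

lemma splits_unique:
  assumes "splits u a b" "splits u a' b'"
  shows "a = a'" "b = b'"
  using assms side_decomposition_unique[of a b a' b'] by (auto simp: splits_def)

lemma splits_mult_left:
  assumes "splits u a b"
  shows "\<phi> (x * u) = \<phi> x * a + b * \<phi> x"
  using assms by (simp add: mult_swap[where x = u] splits_def algebra_simps)

lemma splits_zero: "splits 0 0 0"
  by (simp add: splits_def zero side_closed generated_image_closed)

lemma splits_add: "splits u a b \<Longrightarrow> splits u' a' b' \<Longrightarrow> splits (u + u') (a + a') (b + b')"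
  by (simp add: splits_def add side_closed generated_image_closed algebra_simps)

lemma splits_minus: "splits u a b \<Longrightarrow> splits (- u) (- a) (- b)"
  by (simp add: splits_def minus side_closed generated_image_closed)

text \<open>The product rule for \<open>u\<close>, taken at \<open>x * y\<close>, factors: \<phi> is
  multiplicative to the right of \<open>a\<close> and antimultiplicative to the left of
  \<open>b\<close>.\<close>

lemma splits_times_right:
  assumes "splits u a b"
  shows "splits (u * x) (a * \<phi> x) (\<phi> x * b)"
  using assms hom_side_mult_map[of a] map_mult_anti_side[of b]
  by (simp add: splits_def side_closed generated_image_closed map_in_generated_image mult.assoc)

lemma splits_times_left:
  assumes u: "splits u a b"
  shows "splits (x * u) (\<phi> x * a) (b * \<phi> x)"
proof -
  \<comment> \<open>Reading the product as \<open>x * (u * y)\<close> allows the left rule for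
    \<open>u * y\<close>, which splits by \<open>splits_times_right\<close>.\<close>
  have "\<phi> (x * u * y) = \<phi> x * a * \<phi> y + \<phi> y * (b * \<phi> x)" for y
    using splits_mult_left[OF splits_times_right[OF u], of x y] by (simp add: mult.assoc)
  with u splits_mult_left[OF u, of x] show ?thesis
    by (simp add: splits_def side_closed generated_image_closed map_in_generated_image)
qed

section \<open>Splitting on the commutator ideal\<close>

lemma splits_commutator: "splits (x * y - y * x) (anti_defect x y) (hom_defect x y)"
proof -
  have "\<phi> (x * y - y * x) = anti_defect x y + hom_defect x y"
    by (simp add: diff mult_swap[of x y] hom_defect_def anti_defect_def)
  moreover have "\<phi> ((x * y - y * x) * z) = anti_defect x y * \<phi> z + \<phi> z * hom_defect x y" for z
  proof -
    \<comment> \<open>\<open>\<phi>\<close> is multiplicative modulo \<open>anti_side\<close> and antimultiplicative modulo \<open>hom_side\<close>,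
      and the identity holds in both of these cases.\<close>
    define D where
      "D = \<phi> ((x * y - y * x) * z) - (anti_defect x y * \<phi> z + \<phi> z * hom_defect x y)"
    have "D = hom_defect (x * y) z - hom_defect (y * x) z - hom_defect y x * \<phi> z
        - \<phi> z * hom_defect x y"
      by (simp add: D_def hom_defect_def anti_defect_def diff algebra_simps)
    then have "D \<in> anti_side" by (simp add: side_closed hom_defect_in_anti_side)
    moreover have "D = anti_defect (x * y) z - anti_defect (y * x) z - \<phi> z * anti_defect y x
        - anti_defect x y * \<phi> z"
      by (simp add: D_def hom_defect_def anti_defect_def diff algebra_simps)
    then have "D \<in> hom_side" by (simp add: side_closed anti_defect_in_hom_side)
    ultimately show ?thesis using side_Int[of D] by (simp add: D_def)
  qed
  ultimately show ?thesis
    by (simp add: splits_def anti_defect_in_hom_side hom_defect_in_anti_side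
        defect_in_generated_image)
qed

lemma is_ideal_splits: "is_ideal UNIV {u. \<exists>a b. splits u a b}"
  unfolding is_ideal_def additive_subgroup_def
  by (auto intro: splits_zero dest: splits_add splits_minus splits_times_left splits_times_right)

lemma commutator_ideal_splits: "commutator_ideal \<subseteq> {u. \<exists>a b. splits u a b}"
  unfolding commutator_ideal_def
proof (rule hull_minimal)
  show "{x * y - y * x | x y. True} \<subseteq> {u. \<exists>a b. splits u a b}"
    using splits_commutator by blast
qed (rule is_ideal_splits)

text \<open>Once components are chosen as functions, \<open>splits_unique\<close> turns each closure
  rule for \<open>splits\<close> into an identity between them.\<close>

lemma sum_hom_antihom_on_splits:
  assumes "I \<subseteq> {u. \<exists>a b. splits u a b}"
  shows "sum_hom_antihom_on \<phi> I"
proof -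
  let ?J1 = "generated_image \<phi> \<inter> hom_side" and ?J2 = "generated_image \<phi> \<inter> anti_side"
  \<comment> \<open>The choice covers all splitting elements, since \<open>I\<close> is an arbitrary
    subset and need not contain the sums and products evaluated below.\<close>
  have "\<forall>u\<in>{u. \<exists>a b. splits u a b}. \<exists>a b. splits u a b" by simp
  then obtain f g where "\<forall>u\<in>{u. \<exists>a b. splits u a b}. splits u (f u) (g u)"
    unfolding bchoice_iff by blast
  then have fg: "splits u (f u) (g u)" if "splits u a b" for u a b
    using that by blast
  have eq: "f u = a" "g u = b" if "splits u a b" for u a b
    using splits_unique[OF fg[OF that] that] by auto
  have I: "splits u (f u) (g u)" if "u \<in> I" for u
    using that assms fg by blast
  have in_J: "f u \<in> ?J1" "g u \<in> ?J2" if "u \<in> I" for u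
    using I[OF that] by (auto simp: splits_def)
  have map: "\<phi> u = f u + g u" if "u \<in> I" for u
    using I[OF that] by (auto simp: splits_def)
  have add: "f (u + v) = f u + f v" "g (u + v) = g u + g v" if "u \<in> I" "v \<in> I" for u v
    using eq[OF splits_add[OF I[OF that(1)] I[OF that(2)]]] by auto
  have right: "f (u * x) = f u * \<phi> x" "g (u * x) = \<phi> x * g u" if "u \<in> I" for u x
    using eq[OF splits_times_right[OF I[OF that]]] by auto
  have left: "f (x * u) = \<phi> x * f u" "g (x * u) = g u * \<phi> x" if "u \<in> I" for u x
    using eq[OF splits_times_left[OF I[OF that]]] by auto
  \<comment> \<open>Expanding \<open>\<phi> v = f v + g v\<close> in \<open>right\<close> leaves the
    cross terms \<open>f u * g v\<close> and \<open>f v * g u\<close>, which vanish.\<close>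
  have mult: "f (u * v) = f u * f v" "g (u * v) = g v * g u" if "u \<in> I" "v \<in> I" for u v
    using that in_J[OF that(1)] in_J[OF that(2)]
    by (simp_all add: right map distrib_left distrib_right hom_side_mult_anti_side)
  have "hom_on I (generated_image \<phi>) f" "antihom_on I (generated_image \<phi>) g"
    using in_J by (auto simp: hom_on_def antihom_on_def add mult)
  moreover have "is_ideal (generated_image \<phi>) ?J1" "is_ideal (generated_image \<phi>) ?J2"
    by (simp_all add: is_ideal_Int is_subring_generated_image is_ideal_hom_side is_ideal_anti_side)
  moreover have "f ` I \<subseteq> ?J1" "g ` I \<subseteq> ?J2"
    using in_J by blast+
  moreover have "?J1 \<inter> ?J2 = {0}"
    using side_Int side_closed(6,12) generated_image_closed(5) by blast
  ultimately show ?thesis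
    unfolding sum_hom_antihom_on_def
    by (intro exI[of _ f] exI[of _ g] exI[of _ ?J1] exI[of _ ?J2] conjI)
      (simp_all add: map left right)
qed

end

theorem corollary3p17:
  fixes \<phi> :: "'a::ring \<Rightarrow> 'b::ring"
  assumes "reduced_ring TYPE('b)"
    and "jordan_hom \<phi>"
  shows "sum_hom_antihom_on \<phi> commutator_ideal"
proof -
  interpret jordan_hom_to_reduced \<phi>
    using assms by unfold_locales
  show ?thesis
    using commutator_ideal_splits by (rule sum_hom_antihom_on_splits)
qed

end
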